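(* Let $\tau>0$ and let $\mathbf{A},\mathbf{B}\in\mathbb{R}^{2\times 2}$ be of the form $$\mathbf{A}=\begin{bmatrix}0&1\\ a_{21}&a_{22}\end{bmatrix},\qquad \mathbf{B}=\begin{bmatrix}0&0\\ b_{21}&b_{22}\end{bmatrix}.$$ Let $\{\lambda,\bar\lambda\}$ be any pair of complex conjugate (non-real) characteristic roots of the system $\dot{\mathbf{x}}(t)=\mathbf{A}\mathbf{x}(t)+\mathbf{B}\mathbf{x}(t-\tau)$, and assume their multiplicity is one. Then for at least one $k\in\{0,-1\}$ there exists a real matrix $\mathbf{M}_k\in\mathbb{R}^{2\times2}$, of the form $\mathbf{M}_k=\tau\mathbf{B}\mathbf{Q}_k$ for some matrix $\mathbf{Q}_k$, which solves $$\mathbf{W}_k(\mathbf{M}_k)\exp\left(\mathbf{W}_k(\mathbf{M}_k)+\mathbf{A}\tau\right)-\tau\mathbf{B}=\mathbf{0},$$ and such that $\lambda$ and $\bar\lambda$ are the eigenvalues of the matrix $$\mathbf{S}_k=\frac1\tau\mathbf{W}_k(\mathbf{M}_k)+\mathbf{A}.$$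
   Context: Characteristic roots of $\dot{\mathbf{x}}(t)=\mathbf{A}\mathbf{x}(t)+\mathbf{B}\mathbf{x}(t-\tau)$ are the complex zeros $s$ of $\det(s\mathbf{I}-\mathbf{A}-\mathbf{B}e^{-s\tau})$; multiplicity means multiplicity as a zero of this function. Scalar Lambert W function: for $z\in\mathbb{C}$, the multivalued function $W(z)$ is defined by $W(z)e^{W(z)}=z$; $W_k(z)$, $k\in\mathbb{Z}$, denotes its $k$-th branch with the standard branch cuts of Corless et al. (1996). For real arguments, the only real-valued branches are: $W_0$, real on $[-1/e,\infty)$ with range $[-1,\infty)$; and $W_{-1}$, real on $[-1/e,0)$ with range $(-\infty,-1]$. Moreover $W_0(0)=0$, $W_0'(0)=1$, and $W_k(0)=\infty$ for $k\neq0$. Matrix Lambert W function (with the "hybrid branch" convention): let $\mathbf{H}\in\mathbb{C}^{n\times n}$ have Jordan decomposition $\mathbf{H}=\mathbf{Z}\,\mathrm{diag}(\mathbf{J}_1(\lambda_1),\dots,\mathbf{J}_p(\lambda_p))\,\mathbf{Z}^{-1}$. Then $\mathbf{W}_k(\mathbf{H})=\mathbf{Z}\,\mathrm{diag}(\mathbf{W}_k(\mathbf{J}_1(\lambda_1)),\dots,\mathbf{W}_k(\mathbf{J}_p(\lambda_p)))\,\mathbf{Z}^{-1}$, where for a Jordan block $\mathbf{J}_i(\lambda_i)$ of size $m$ with $\lambda_i\ne0$, $\mathbf{W}_k(\mathbf{J}_i(\lambda_i))$ is the $m\times m$ upper triangular Toeplitz matrix whose entry on the $j$-th superdiagonal is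 $\frac{1}{j!}W_k^{(j)}(\lambda_i)$, $j=0,\dots,m-1$; and for blocks with $\lambda_i=0$ the same formula is used with the branch $k$ replaced by $0$ (whatever the value of $k$). When $k=0$ it is assumed that $-e^{-1}$ is not an eigenvalue of $\mathbf{H}$ belonging to a Jordan block of size larger than 1 (since $W_0'(-e^{-1})$ is undefined). $\exp$ denotes the matrix exponential. *)

theory Defs
  imports "HOL-Complex_Analysis.Complex_Analysis" "Jordan_Normal_Form.Spectral_Radius"
begin

section \<open>Characteristic roots of a delay system with one delay\<close>

abbreviation cmat :: "real mat \<Rightarrow> complex mat" where
  "cmat \<equiv> map_mat complex_of_real"

definition char_fun :: "real mat \<Rightarrow> real mat \<Rightarrow> real \<Rightarrow> complex \<Rightarrow> complex" where
  "char_fun A B \<tau> s =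
     Determinant.det (s \<cdot>\<^sub>m 1\<^sub>m (dim_row A) - cmat A - exp (- s * of_real \<tau>) \<cdot>\<^sub>m cmat B)"

definition char_root :: "real mat \<Rightarrow> real mat \<Rightarrow> real \<Rightarrow> complex \<Rightarrow> bool" where
  "char_root A B \<tau> s \<longleftrightarrow> char_fun A B \<tau> s = 0"

definition char_root_mult :: "real mat \<Rightarrow> real mat \<Rightarrow> real \<Rightarrow> complex \<Rightarrow> int" where
  "char_root_mult A B \<tau> s = zorder (char_fun A B \<tau>) s"

section \<open>Matrix exponential\<close>

definition mat_exp :: "complex mat \<Rightarrow> complex mat" where
  "mat_exp H = mat (dim_row H) (dim_row H) (\<lambda>(i,j). \<Sum>m. (H ^\<^sub>m m) $$ (i,j) / fact m)"

section \<open>Branches of the scalar Lambert W function\<close>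

text \<open>
  The ranges of the branches in the partition of the plane of \<open>w = \<xi> + i \<eta>\<close> given by Corless,
  Gonnet, Hare, Jeffrey and Knuth (1996).  The number \<open>w * exp w\<close> is a negative real iff \<open>w\<close>
  is a negative real or \<open>w\<close> lies on one of the curves \<open>\<xi> = - \<eta> * cot \<eta>\<close> with \<open>\<eta>\<close> in
  \<open>(2 k \<pi>, (2 k + 1) \<pi>)\<close> or \<open>(- (2 k + 1) \<pi>, - 2 k \<pi>)\<close>, \<open>k = 0, 1, 2, \<dots>\<close>; these curves
  and the half-line \<open>(-\<infinity>, -1]\<close> are the boundaries between the ranges.  Each branch cut is
  closed on its upper side (counter-clockwise continuity), so a boundary curve belongs to the range
  below it and \<open>(-\<infinity>, -1]\<close> belongs to the branch \<open>-1\<close>, not to the branch \<open>1\<close>.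
  The point \<open>-1\<close> is the common value of the branches \<open>0\<close> and \<open>-1\<close> at \<open>-exp (-1)\<close>.
\<close>

definition lambert_W_range :: "int \<Rightarrow> complex set" where
  "lambert_W_range k = {w. let \<xi> = Re w; \<eta> = Im w in
     if k = 0 then
       \<eta> = 0 \<and> -1 \<le> \<xi>
       \<or> 0 < \<eta> \<and> \<eta> < pi \<and> - \<eta> * cot \<eta> \<le> \<xi>
       \<or> - pi < \<eta> \<and> \<eta> < 0 \<and> - \<eta> * cot \<eta> < \<xi>
     else if k > 0 then
       (2 * k - 2) * pi < \<eta> \<and> \<eta> < (2 * k - 1) * pi \<and> \<xi> < - \<eta> * cot \<eta>
       \<or> (2 * k - 1) * pi \<le> \<eta> \<and> \<eta> \<le> 2 * k * pi
       \<or> 2 * k * pi < \<eta> \<and> \<eta> < (2 * k + 1) * pi \<and> - \<eta> * cot \<eta> \<le> \<xi>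
     else
       k = -1 \<and> \<eta> = 0 \<and> \<xi> \<le> -1
       \<or> (2 * k + 1) * pi < \<eta> \<and> \<eta> < (2 * k + 2) * pi \<and> \<xi> \<le> - \<eta> * cot \<eta>
       \<or> 2 * k * pi \<le> \<eta> \<and> \<eta> \<le> (2 * k + 1) * pi
       \<or> (2 * k - 1) * pi < \<eta> \<and> \<eta> < 2 * k * pi \<and> - \<eta> * cot \<eta> < \<xi>}"

text \<open>For \<open>k \<noteq> 0\<close> the value at \<open>0\<close> (where the branch is infinite) is unspecified.\<close>

definition lambert_W :: "int \<Rightarrow> complex \<Rightarrow> complex" where
  "lambert_W k z = (THE w. w * exp w = z \<and> w \<in> lambert_W_range k)"

text \<open>
  The \<open>j\<close>-th derivative of the branch \<open>k\<close> at \<open>z\<close>.  Away from the branch cut, the germ \<open>g\<close>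
  below coincides with the branch itself.  On the cut, where the branch is continuous from
  above only, \<open>g\<close> is its analytic continuation from above.
  At the branch point \<open>-exp (-1)\<close> of the branches \<open>0\<close> and \<open>-1\<close> there is no such \<open>g\<close>, and the
  derivatives of positive order are unspecified.
\<close>

definition lambert_W_deriv :: "int \<Rightarrow> nat \<Rightarrow> complex \<Rightarrow> complex" where
  "lambert_W_deriv k j z =
     (if j = 0 then lambert_W k z
      else (deriv ^^ j) (SOME g. g analytic_on {z} \<and>
             (\<forall>\<^sub>F u in nhds z. Im z \<le> Im u \<longrightarrow> g u = lambert_W k u)) z)"

section \<open>The matrix Lambert W function with hybrid branches\<close>

definition lambert_W_block :: "int \<Rightarrow> nat \<times> complex \<Rightarrow> complex mat" where
  "lambert_W_block k = (\<lambda>(m, \<mu>). mat m m (\<lambda>(i,j).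
     if i \<le> j then lambert_W_deriv (if \<mu> = 0 then 0 else k) (j - i) \<mu> / fact (j - i) else 0))"

definition jordan_decomp ::
    "complex mat \<Rightarrow> (nat \<times> complex) list \<Rightarrow> complex mat \<Rightarrow> complex mat \<Rightarrow> bool" where
  "jordan_decomp H n_as Z Zinv \<longleftrightarrow>
     0 \<notin> fst ` set n_as \<and> similar_mat_wit H (jordan_matrix n_as) Z Zinv"

text \<open>The result does not depend on the Jordan decomposition that is chosen, because the branch
  used for a block depends only on its eigenvalue.\<close>

definition mat_lambert_W :: "int \<Rightarrow> complex mat \<Rightarrow> complex mat" where
  "mat_lambert_W k H =
     (case (SOME (n_as, Z, Zinv). jordan_decomp H n_as Z Zinv) of (n_as, Z, Zinv) \<Rightarrow>
        Z * diag_block_mat (map (lambert_W_block k) n_as) * Zinv)"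

text \<open>The first derivative of the branch \<open>-1\<close> is undefined at \<open>-exp (-1)\<close>, too.\<close>

definition mat_lambert_W_defined :: "int \<Rightarrow> complex mat \<Rightarrow> bool" where
  "mat_lambert_W_defined k H \<longleftrightarrow>
     (k \<in> {0, -1} \<longrightarrow>
       (\<forall>n_as m. jordan_nf H n_as \<and> (m, - exp (-1)) \<in> set n_as \<longrightarrow> m = 1))"

end

theory Submission
  imports Defs
begin

text \<open>
  Every matrix \<open>M = \<tau> B Q\<close> has a zero top row, so its spectrum consists of \<open>0\<close> and of its lower
  right entry \<open>h\<close>.  If \<open>h = w exp w\<close> with \<open>w\<close> real and \<open>W\<^sub>k(h) = w\<close>, then, with the hybrid branch
  convention, \<open>W\<^sub>k\<close> agrees with multiplication by \<open>exp (- w)\<close> at both eigenvalues.  The matrix \<open>M\<close>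
  is diagonalizable unless \<open>h = 0\<close>, and in that case \<open>w = 0\<close> and \<open>W\<^sub>0(z) = z + O(z\<^sup>2)\<close> fixes the
  nilpotent matrix \<open>M\<close>.  Hence always \<open>W\<^sub>k(M) = exp (- w) M\<close>
  (\<open>mat_lambert_W_of_zero_top_row\<close>).  Therefore every real matrix with a zero top row, and with
  bottom row \<open>(w\<^sub>1, w\<^sub>2)\<close> say, is a value \<open>W\<^sub>k(M)\<close>: take \<open>M\<close> to be \<open>exp w\<^sub>2\<close> times that matrix.
  The branch is \<open>0\<close> if \<open>w\<^sub>2 \<ge> -1\<close> and \<open>-1\<close> if \<open>w\<^sub>2 \<le> -1\<close>, because the real values of these
  two branches are \<open>[-1, \<infinity>)\<close> and \<open>(-\<infinity>, -1]\<close>.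

  The matrix \<open>S = W\<^sub>k(M) / \<tau> + A\<close> then has top row \<open>(0, 1)\<close> and an arbitrary real bottom row, so
  that it can be made the companion matrix of \<open>(z - \<mu>) (z - cnj \<mu>)\<close>.  Its eigenvectors are
  \<open>v = (1, z)\<close> for \<open>z = \<mu>\<close> and \<open>z = cnj \<mu>\<close>, and as \<open>A\<close> and \<open>B\<close> share the companion shape, these
  vectors also span the kernels of the characteristic matrices of the delay system: \<open>(z - A) v =
  exp (- z \<tau>) B v\<close>.  Consequently \<open>W\<^sub>k(M) exp (\<tau> S) v = \<tau> exp (z \<tau>) (S - A) v = \<tau> B v\<close> for both
  eigenvectors, which are a basis because \<open>\<mu>\<close> is not real (\<open>mult_mat_exp_eqI\<close>).

  Finally \<open>M\<close> must have the form \<open>\<tau> B Q\<close>.  If \<open>B \<noteq> 0\<close>, its bottom row \<open>b\<close> is nonzero, and every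
  row has the form \<open>b Q\<close>.  If \<open>B = 0\<close>, the characteristic equation forces \<open>S = A\<close> and \<open>M = 0\<close>.

  The analytic work is the evaluation of the branches, which are specified by their ranges:
  in the range of branch \<open>0\<close> or \<open>-1\<close>, no other point shares its value of \<open>w exp w\<close> with a real point
  (\<open>lambert_W_0_of_real\<close>, \<open>lambert_W_minus_1_of_real\<close>); and near \<open>0\<close> branch \<open>0\<close> is the local inverse of
  \<open>w \<mapsto> w exp w\<close> (\<open>lambert_W_0_analytic_germ\<close>).
\<close>

section \<open>The values of \<open>w exp w\<close> off the real line\<close>

text \<open>Off the real line, \<open>w exp w\<close> is real only on the curves \<open>\<xi> = - \<eta> cot \<eta>\<close>, and its sign there is
  that of \<open>- \<eta> / sin \<eta>\<close>.  The curves with negative values are the boundaries between the ranges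
  of the branches.\<close>

lemma w_exp_w_eq_of_realD:
  fixes w :: complex
  assumes eq: "w * exp w = of_real x" and nz: "Im w \<noteq> 0"
  shows "sin (Im w) \<noteq> 0" "Re w = - Im w * cot (Im w)"
    "x = - (exp (Re w) * (Im w / sin (Im w)))"
proof -
  have im: "exp (Re w) * (Re w * sin (Im w) + Im w * cos (Im w)) = 0"
    using arg_cong[OF eq, of Im] by (simp add: Im_exp Re_exp algebra_simps)
  then have im': "Re w * sin (Im w) = - Im w * cos (Im w)"
    by simp
  have re: "exp (Re w) * (Re w * cos (Im w) - Im w * sin (Im w)) = x"
    using arg_cong[OF eq, of Re] by (simp add: Im_exp Re_exp algebra_simps)
  show s: "sin (Im w) \<noteq> 0"
    using im' nz sin_zero_norm_cos_one by fastforce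
  show re_eq: "Re w = - Im w * cot (Im w)"
    using im' s by (simp add: cot_def field_simps)
  have "(Re w * cos (Im w) - Im w * sin (Im w)) * sin (Im w)
      = - Im w * (cos (Im w) ^ 2 + sin (Im w) ^ 2)"
  proof -
    have "(Re w * cos (Im w) - Im w * sin (Im w)) * sin (Im w)
        = cos (Im w) * (Re w * sin (Im w)) - Im w * sin (Im w) ^ 2"
      by (simp add: algebra_simps power2_eq_square)
    also have "\<dots> = - Im w * (cos (Im w) ^ 2 + sin (Im w) ^ 2)"
      unfolding im' by (simp only: power2_eq_square ring_distribs) simp
    finally show ?thesis .
  qed
  then have "Re w * cos (Im w) - Im w * sin (Im w) = - (Im w / sin (Im w))"
    using s by (simp add: field_simps)
  then show "x = - (exp (Re w) * (Im w / sin (Im w)))"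
    using re by simp
qed

lemma mult_cos_less_sin:
  fixes t :: real
  assumes "0 < t" "t < pi"
  shows "t * cos t < sin t"
proof -
  have "(\<lambda>t. sin t - t * cos t) 0 < (\<lambda>t. sin t - t * cos t) t"
  proof (rule DERIV_pos_imp_increasing_open[OF assms(1)])
    fix x :: real assume "0 < x" "x < t"
    moreover have "((\<lambda>t. sin t - t * cos t) has_real_derivative x * sin x) (at x)"
      by (auto intro!: derivative_eq_intros)
    ultimately show "\<exists>y. ((\<lambda>t. sin t - t * cos t) has_real_derivative y) (at x) \<and> y > 0"
      using assms by (intro exI[of _ "x * sin x"] conjI mult_pos_pos sin_gt_zero) auto
  qed (auto intro!: continuous_intros)
  then show ?thesis by simp
qed

lemma mult_cot_less_one:
  fixes t :: real
  assumes "t \<noteq> 0" "\<bar>t\<bar> < pi"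
  shows "t * cot t < 1"
proof -
  have "\<bar>t\<bar> * cos \<bar>t\<bar> < sin \<bar>t\<bar>" "0 < sin \<bar>t\<bar>"
    using assms by (simp_all only: mult_cos_less_sin sin_gt_zero zero_less_abs_iff not_False_eq_True)
  then have "\<bar>t\<bar> * cot \<bar>t\<bar> < 1"
    by (simp add: cot_def field_simps)
  then show ?thesis
    by (simp add: abs_if cot_def split: if_splits)
qed

lemma one_le_div_sin:
  fixes t :: real
  assumes "t \<noteq> 0" "\<bar>t\<bar> < pi"
  shows "1 \<le> t / sin t"
proof -
  have "0 < sin \<bar>t\<bar>"
    using assms by (auto intro!: sin_gt_zero)
  then have "1 \<le> \<bar>t\<bar> / sin \<bar>t\<bar>"
    using sin_x_le_x[of "\<bar>t\<bar>"] by simp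
  then show ?thesis
    by (simp add: abs_if split: if_splits)
qed

text \<open>In the strip \<open>\<bar>\<eta>\<bar> < \<pi>\<close> the boundary curve passes through \<open>w = -1\<close>, with the value \<open>- exp (-1)\<close>
  at the branch point.  Elsewhere on it \<open>\<xi> > -1\<close> and \<open>\<eta> / sin \<eta> \<ge> 1\<close>, which makes the value
  smaller.  Hence, in this strip, values from \<open>- exp (-1)\<close> upwards are taken at real points
  only.\<close>

lemma w_exp_w_real_less_branch_point:
  fixes w :: complex
  assumes eq: "w * exp w = of_real x" and nz: "Im w \<noteq> 0" and less: "\<bar>Im w\<bar> < pi"
  shows "x < - exp (- 1)"
proof -
  have "- 1 < Re w"
    using w_exp_w_eq_of_realD(2)[OF eq nz] mult_cot_less_one[OF nz less] by simp
  then have "exp (- 1) * 1 < exp (Re w) * (Im w / sin (Im w))"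
    using one_le_div_sin[OF nz less] by (intro mult_less_le_imp_less) auto
  then show ?thesis
    using w_exp_w_eq_of_realD(3)[OF eq nz] by simp
qed

section \<open>Real values of the branches 0 and -1\<close>

lemma real_w_exp_w_ge:
  fixes w :: real
  shows "- exp (- 1) \<le> w * exp w"
proof -
  have "(- w) * exp w \<le> exp (- 1 - w) * exp w"
    using exp_ge_add_one_self[of "- 1 - w"] by (intro mult_right_mono) auto
  also have "\<dots> = exp (- 1)"
    by (simp flip: exp_add)
  finally show ?thesis by simp
qed

lemma exp_gt_add_one_self:
  fixes x :: real
  assumes "x \<noteq> 0"
  shows "1 + x < exp x"
proof -
  have "1 + x \<noteq> exp x"
  proof
    assume "1 + x = exp x"
    then have "1 + x > 0" by simp
    moreover have "ln (1 + x) = x" using \<open>1 + x = exp x\<close> by (metis ln_exp)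
    ultimately show False using ln_eq_minus_one[of "1 + x"] assms by simp
  qed
  then show ?thesis using exp_ge_add_one_self[of x] by (simp only: order_less_le simp_thms)
qed

text \<open>The function \<open>w exp w\<close> turns at \<open>-1\<close>, so two points with the same value lie on different
  sides of \<open>-1\<close>.  Both claims come from \<open>a = b exp d\<close> with \<open>d = b - a\<close> and the strict
  inequality \<open>1 + x < exp x\<close>; together they yield the injectivity on either side.\<close>

lemma real_w_exp_w_collision:
  fixes a b :: real
  assumes eq: "a * exp a = b * exp b" and less: "a < b"
  shows "a < - 1" "- 1 < b"
proof -
  define d where "d = b - a"
  have d: "d > 0" "b = a + d" using less by (auto simp: d_def)
  have *: "a = b * exp d"
  proof -
    have "a * exp a = (b * exp d) * exp a"
      using eq d by (simp add: exp_add mult_ac)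
    then show ?thesis by simp
  qed
  have **: "b = a * exp (- d)"
    using * by (simp add: exp_minus)
  have e: "1 + d < exp d" "1 - d < exp (- d)"
    using exp_gt_add_one_self[of d] exp_gt_add_one_self[of "- d"] d by auto
  show "- 1 < b"
  proof (rule ccontr)
    assume "\<not> - 1 < b"
    then have "b * (exp d - 1) \<le> - 1 * (exp d - 1)"
      using e d by (intro mult_right_mono) auto
    moreover have "b * (exp d - 1) = - d"
      unfolding right_diff_distrib using * d(2) by linarith
    ultimately have "exp d \<le> 1 + d"
      unfolding mult_minus1 minus_diff_eq by linarith
    with e(1) show False by (meson leD)
  qed
  show "a < - 1"
  proof (rule ccontr)
    assume "\<not> a < - 1"
    then have "- 1 * (1 - exp (- d)) \<le> a * (1 - exp (- d))"
      using d by (intro mult_right_mono) auto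
    moreover have "a * (1 - exp (- d)) = - d"
      unfolding right_diff_distrib using ** d(2) by linarith
    ultimately have "exp (- d) \<le> 1 - d"
      unfolding mult_minus1 minus_diff_eq by linarith
    with e(2) show False by (meson leD)
  qed
qed

lemma lambert_W_range_0D:
  assumes "w \<in> lambert_W_range 0"
  shows "\<bar>Im w\<bar> < pi" "- 1 \<le> Re w"
proof -
  show less: "\<bar>Im w\<bar> < pi"
    using assms by (auto simp: lambert_W_range_def Let_def)
  show "- 1 \<le> Re w"
  proof (cases "Im w = 0")
    case False
    with mult_cot_less_one[OF False less] assms show ?thesis
      by (auto simp: lambert_W_range_def Let_def)
  qed (use assms in \<open>auto simp: lambert_W_range_def Let_def\<close>)
qed

lemma Re_w_exp_w_eq:
  fixes u :: complex
  assumes "u * exp u = of_real x" "Im u = 0"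
  shows "Re u * exp (Re u) = x"
  using arg_cong[OF assms(1), of Re] assms(2) by (simp add: Re_exp Im_exp)

text \<open>The range of branch \<open>0\<close> contains its upper boundary curve, where \<open>w exp w\<close> is real, but there
  the values are below \<open>- exp (-1)\<close>.\<close>

lemma lambert_W_0_of_real:
  fixes w :: real
  assumes "- 1 \<le> w"
  shows "lambert_W 0 (of_real (w * exp w)) = of_real w"
  unfolding lambert_W_def
proof (rule the_equality)
  show "of_real w * exp (of_real w) = complex_of_real (w * exp w)
      \<and> of_real w \<in> lambert_W_range 0"
    using assms by (simp add: exp_of_real lambert_W_range_def)
next
  fix u :: complex
  assume u: "u * exp u = of_real (w * exp w) \<and> u \<in> lambert_W_range 0"
  have im: "Im u = 0"
    using w_exp_w_real_less_branch_point[of u "w * exp w"] u lambert_W_range_0D(1)[of u]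
      real_w_exp_w_ge[of w] by fastforce
  then have ur: "u = of_real (Re u)" by (simp add: complex_eq_iff)
  have "Re u * exp (Re u) = w * exp w"
    using Re_w_exp_w_eq[OF _ im] u by blast
  then have "Re u = w"
    using real_w_exp_w_collision(1)[of "Re u" w] real_w_exp_w_collision(1)[of w "Re u"]
      lambert_W_range_0D(2)[of u] u assms by argo
  then show "u = of_real w" using ur by simp
qed

text \<open>At nonreal points of the range of branch \<open>-1\<close>, \<open>w exp w\<close> misses the interval from \<open>- exp (-1)\<close>
  to \<open>0\<close>: its real values are too small for \<open>- \<pi> < \<eta> < 0\<close> and positive for
  \<open>- 2 \<pi> < \<eta> < - \<pi>\<close>; there are none on the lines \<open>\<eta> = - \<pi>\<close> and \<open>\<eta> = - 2 \<pi>\<close>; and below these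
  lines the range omits its boundary curve.\<close>

lemma lambert_W_minus_1_of_real:
  fixes w :: real
  assumes "w \<le> - 1"
  shows "lambert_W (- 1) (of_real (w * exp w)) = of_real w"
  unfolding lambert_W_def
proof (rule the_equality)
  show "of_real w * exp (of_real w) = complex_of_real (w * exp w)
      \<and> of_real w \<in> lambert_W_range (- 1)"
    using assms by (simp add: exp_of_real lambert_W_range_def)
next
  fix u :: complex
  assume u: "u * exp u = of_real (w * exp w) \<and> u \<in> lambert_W_range (- 1)"
  define x where "x = w * exp w"
  have x: "- exp (- 1) \<le> x" "x < 0" "u * exp u = of_real x"
    using real_w_exp_w_ge[of w] assms u by (auto simp: x_def mult_neg_pos)
  have im: "Im u = 0"
  proof (rule ccontr)
    assume nz: "Im u \<noteq> 0"
    note D = w_exp_w_eq_of_realD[OF x(3) nz]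
    have far: "\<not> \<bar>Im u\<bar> < pi"
      using w_exp_w_real_less_branch_point[OF x(3) nz] x(1) by auto
    have range: "- 2 * pi \<le> Im u \<and> Im u \<le> - pi
        \<or> - 3 * pi < Im u \<and> Im u < - 2 * pi \<and> - Im u * cot (Im u) < Re u"
      using u far nz by (auto simp: lambert_W_range_def Let_def)
    have "Im u \<noteq> - pi" "Im u \<noteq> - 2 * pi"
      using D(1) by (auto simp: sin_minus[of "2 * pi"])
    with range D(2) have "- 2 * pi < Im u" "Im u < - pi" by auto
    then have "0 < sin (Im u)"
      using sin_gt_zero[of "Im u + 2 * pi"] by simp
    then have "Im u / sin (Im u) < 0"
      using \<open>Im u < - pi\<close> pi_gt_zero by (intro divide_neg_pos) linarith+
    then have "x > 0"
      using D(3) mult_pos_neg[OF exp_gt_zero[of "Re u"]] by (simp only: neg_0_less_iff_less)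
    with x(2) show False by simp
  qed
  then have ur: "u = of_real (Re u)" by (simp add: complex_eq_iff)
  have "Re u * exp (Re u) = w * exp w"
    using Re_w_exp_w_eq[OF _ im] u by blast
  moreover have "Re u \<le> - 1"
    using conjunct2[OF u] im pi_gt_zero by (simp add: lambert_W_range_def)
  ultimately have "Re u = w"
    using real_w_exp_w_collision(2)[of "Re u" w] real_w_exp_w_collision(2)[of w "Re u"] assms
    by argo
  then show "u = of_real w" using ur by simp
qed

section \<open>Branch 0 near the origin\<close>

lemma cball_half_subset_lambert_W_range_0:
  assumes "norm w \<le> 1 / 2"
  shows "w \<in> lambert_W_range 0"
proof -
  have re: "\<bar>Re w\<bar> \<le> 1 / 2" and im: "\<bar>Im w\<bar> \<le> 1 / 2"
    using abs_Re_le_cmod[of w] abs_Im_le_cmod[of w] assms by auto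
  have "1 / 2 < Im w * cot (Im w)" if "Im w \<noteq> 0"
  proof -
    have "\<bar>Im w\<bar> < pi / 3" using im pi_gt3 by simp
    then have "cos (pi / 3) < cos \<bar>Im w\<bar>"
      by (intro cos_monotone_0_pi) auto
    then have c: "1 / 2 < cos (Im w)"
      by (simp add: cos_60)
    have "1 * cos (Im w) \<le> (Im w / sin (Im w)) * cos (Im w)"
      using one_le_div_sin[OF that] im pi_gt3 c by (intro mult_right_mono) auto
    also have "\<dots> = Im w * cot (Im w)" by (simp add: cot_def)
    finally show ?thesis using c by simp
  qed
  then show ?thesis
    using re im pi_gt3 by (auto simp: lambert_W_range_def Let_def)
qed

text \<open>Branch \<open>0\<close> is small at small arguments because \<open>Re w \<ge> -1\<close> in its range.  This excludes
  competitors far from the origin when the branch is identified with the local inverse.\<close>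

lemma norm_le_of_w_exp_w:
  assumes "w \<in> lambert_W_range 0"
  shows "norm w \<le> exp 1 * norm (w * exp w)"
proof -
  have "norm w * 1 \<le> norm w * exp (1 + Re w)"
    using lambert_W_range_0D(2)[OF assms] by (intro mult_left_mono) auto
  then show ?thesis by (simp add: norm_mult exp_add mult_ac)
qed

lemma lambert_W_0_analytic_germ:
  obtains h where "h analytic_on {0}" "(h has_field_derivative 1) (at 0)"
    "\<forall>\<^sub>F u in nhds 0. lambert_W 0 u = h u"
proof -
  define f :: "complex \<Rightarrow> complex" where "f = (\<lambda>w. w * exp w)"
  have hol: "f holomorphic_on S" for S
    unfolding f_def by (intro holomorphic_intros)
  have "(f has_field_derivative 1) (at 0)"
    unfolding f_def by (auto intro!: derivative_eq_intros)
  then have deriv_f: "deriv f 0 = 1" by (rule DERIV_imp_deriv)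
  obtain r where r: "r > 0" "ball 0 r \<subseteq> ball (0 :: complex) (1 / 2)" "inj_on f (ball 0 r)"
  proof (rule has_complex_derivative_locally_injective[OF hol])
    show "(0 :: complex) \<in> ball 0 (1 / 2)" "deriv f 0 \<noteq> 0"
      by (simp_all add: deriv_f)
  qed auto
  obtain h where h: "h holomorphic_on f ` ball 0 r"
    "\<And>z. z \<in> ball 0 r \<Longrightarrow> deriv f z * deriv h (f z) = 1"
    "\<And>z. z \<in> ball 0 r \<Longrightarrow> h (f z) = z"
    using holomorphic_has_inverse[OF hol open_ball r(3)] by metis
  have op: "open (f ` ball 0 r)"
    using open_mapping_thm3[OF hol open_ball r(3)] .
  have "f 0 = 0" by (simp add: f_def)
  then have mem: "0 \<in> f ` ball 0 r"
    using r(1) by (metis centre_in_ball imageI)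
  have an: "h analytic_on {0}"
    using h(1) op mem analytic_at by blast
  have "deriv h 0 = 1"
    using h(2)[of 0] r(1) deriv_f \<open>f 0 = 0\<close> by simp
  then have der: "(h has_field_derivative 1) (at 0)"
    using holomorphic_derivI[OF h(1) op mem] by simp
  have "\<forall>\<^sub>F u in nhds 0. u \<in> f ` ball 0 r"
    using op mem by (rule eventually_nhds_in_open)
  moreover have "\<forall>\<^sub>F u in nhds (0 :: complex). u \<in> ball 0 (r / exp 1)"
    using r(1) by (intro eventually_nhds_in_open) auto
  ultimately have "\<forall>\<^sub>F u in nhds 0. lambert_W 0 u = h u"
  proof eventually_elim
    case (elim u)
    then obtain w where w: "w \<in> ball 0 r" "u = f w" by auto
    show ?case
      unfolding lambert_W_def
    proof (rule the_equality)
      have "norm w \<le> 1 / 2" using w(1) r(2) by (auto dest!: subsetD)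
      then show "h u * exp (h u) = u \<and> h u \<in> lambert_W_range 0"
        using h(3)[OF w(1)] w(2) cball_half_subset_lambert_W_range_0[of w]
        by (simp add: f_def)
    next
      fix v assume v: "v * exp v = u \<and> v \<in> lambert_W_range 0"
      then have "norm v \<le> exp 1 * norm u"
        using norm_le_of_w_exp_w[of v] by auto
      also have "\<dots> < r" using elim by (simp add: field_simps)
      finally have "v \<in> ball 0 r" by simp
      then have "h (f v) = v" by (rule h(3))
      then show "v = h u" using v by (simp add: f_def)
    qed
  qed
  with an der show ?thesis by (rule that)
qed

text \<open>The derivative is that of a germ \<open>g\<close> which is only known to agree with the branch in the closed
  upper half-plane.  This includes the real line, along which the derivative can be computed.\<close>

lemma lambert_W_deriv_0_1_0: "lambert_W_deriv 0 1 0 = 1"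
proof -
  obtain h where h: "h analytic_on {0}" "(h has_field_derivative 1) (at 0)"
    "\<forall>\<^sub>F u in nhds 0. lambert_W 0 u = h u"
    by (rule lambert_W_0_analytic_germ)
  define P where "P = (\<lambda>g. g analytic_on {0}
    \<and> (\<forall>\<^sub>F u in nhds 0. Im 0 \<le> Im u \<longrightarrow> g u = lambert_W 0 u))"
  define g where "g = (SOME g. P g)"
  have "P h"
    using h(1,3) by (auto simp: P_def elim: eventually_mono)
  then have "P g" unfolding g_def by (rule someI[of P])
  then have g: "g analytic_on {0}" "\<forall>\<^sub>F u in nhds 0. Im 0 \<le> Im u \<longrightarrow> g u = lambert_W 0 u"
    by (auto simp: P_def)
  have dg: "(g has_field_derivative deriv g 0) (at 0)"
    using g(1) by (meson analytic_on_imp_differentiable_at field_differentiable_derivI insertI1)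
  have ev: "\<forall>\<^sub>F u in nhds 0. Im 0 \<le> Im u \<longrightarrow> g u = h u"
    using g(2) h(3) by eventually_elim auto
  have "((of_real :: real \<Rightarrow> complex) \<longlongrightarrow> of_real 0) (nhds 0)"
    by (intro tendsto_intros filterlim_ident)
  then have "filterlim (of_real :: real \<Rightarrow> complex) (nhds 0) (nhds 0)"
    by simp
  from filterlim_iff[THEN iffD1, OF this, rule_format, OF ev]
  have ev': "\<forall>\<^sub>F t in nhds 0. g (of_real t) = h (of_real t)"
    by simp
  have "((\<lambda>t. g (of_real t)) has_vector_derivative deriv g 0) (at 0)"
    "((\<lambda>t. h (of_real t)) has_vector_derivative 1) (at 0)"
    using dg h(2) by (auto intro!: has_vector_derivative_real_field)
  moreover from this(1) have "((\<lambda>t. h (of_real t)) has_vector_derivative deriv g 0) (at 0)"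
    using has_vector_derivative_cong_ev[of UNIV "\<lambda>t. g (of_real t)" "\<lambda>t. h (of_real t)" 0]
      ev' eventually_nhds_x_imp_x[OF ev'] by simp
  ultimately have "deriv g 0 = 1"
    using vector_derivative_unique_at by blast
  then show ?thesis
    by (simp add: lambert_W_deriv_def g_def P_def)
qed


section \<open>The exponential of a diagonalizable matrix\<close>

lemma mat_diag_pow: "mat_diag n d ^\<^sub>m m = mat_diag n (\<lambda>i. d i ^ m :: 'a :: comm_semiring_1)"
proof (induction m)
  case 0
  then show ?case by (simp add: mat_diag_def one_mat_def)
next
  case (Suc m)
  then show ?case by (simp add: mult.commute)
qed

lemma mat_diag_conj_index:
  assumes "P \<in> carrier_mat n n" "Q \<in> carrier_mat n n" "i < n" "j < n"
  shows "(P * mat_diag n d * Q) $$ (i, j)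
    = (\<Sum>l<n. P $$ (i, l) * d l * Q $$ (l, j) :: 'a :: comm_semiring_1)"
  using assms
  by (simp add: mat_diag_mult_right scalar_prod_def atLeast0LessThan)

lemma mat_exp_diagonalizable:
  assumes H: "H \<in> carrier_mat n n" and wit: "similar_mat_wit H (mat_diag n d) P Q"
  shows "mat_exp H = P * mat_diag n (\<lambda>i. exp (d i)) * Q"
proof (rule eq_matI)
  note PQ = similar_mat_witD2(6,7)[OF H wit]
  fix i j
  assume "i < dim_row (P * mat_diag n (\<lambda>i. exp (d i)) * Q)"
    "j < dim_col (P * mat_diag n (\<lambda>i. exp (d i)) * Q)"
  then have ij: "i < n" "j < n" using PQ by auto
  have entry: "(H ^\<^sub>m m) $$ (i, j) / fact m
      = (\<Sum>l<n. P $$ (i, l) * Q $$ (l, j) * (d l ^ m /\<^sub>R fact m))" for m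
    by (simp add: similar_mat_wit_pow_id[OF wit] mat_diag_pow mat_diag_conj_index[OF PQ ij]
        sum_divide_distrib scaleR_conv_of_real field_simps)
  have "(\<lambda>m. (H ^\<^sub>m m) $$ (i, j) / fact m)
      sums (\<Sum>l<n. P $$ (i, l) * Q $$ (l, j) * exp (d l))"
    unfolding entry by (intro sums_sum sums_mult exp_converges)
  then show "mat_exp H $$ (i, j) = (P * mat_diag n (\<lambda>i. exp (d i)) * Q) $$ (i, j)"
    using ij H by (simp add: mat_exp_def mat_diag_conj_index[OF PQ ij] sums_iff mult_ac)
qed (use H similar_mat_witD2(6,7)[OF H wit] in \<open>auto simp: mat_exp_def\<close>)

section \<open>Matrices of size two\<close>

lemma mat2_eqI:
  assumes "A \<in> carrier_mat 2 2" "B \<in> carrier_mat 2 2"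
    and "A $$ (0, 0) = B $$ (0, 0)" "A $$ (0, 1) = B $$ (0, 1)"
    and "A $$ (1, 0) = B $$ (1, 0)" "A $$ (1, 1) = B $$ (1, 1)"
  shows "A = B"
  using assms by (intro eq_matI) (auto simp: less_2_cases_iff)

lemma mat2_mult_index:
  fixes A B :: "'a :: semiring_0 mat"
  assumes "A \<in> carrier_mat 2 2" "B \<in> carrier_mat 2 2" "i < 2" "j < 2"
  shows "(A * B) $$ (i, j) = A $$ (i, 0) * B $$ (0, j) + A $$ (i, 1) * B $$ (1, j)"
  using assms by (simp add: scalar_prod_def numeral_2_eq_2)

lemma det_mat2:
  fixes A :: "'a :: comm_ring_1 mat"
  assumes A: "A \<in> carrier_mat 2 2"
  shows "Determinant.det A = A $$ (0, 0) * A $$ (1, 1) - A $$ (0, 1) * A $$ (1, 0)"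
proof -
  have d: "Determinant.det (mat_delete A 0 j) = mat_delete A 0 j $$ (0, 0)" for j
  proof (rule det_single)
    show "mat_delete A 0 j \<in> carrier_mat 1 1"
      using mat_delete_dim[of A 0 j] A by (intro carrier_matI) auto
  qed
  have "Determinant.det A = (\<Sum>j<2. A $$ (0, j) * cofactor A 0 j)"
    by (rule laplace_expansion_row[OF A]) simp
  then show ?thesis
    using A by (simp add: numeral_2_eq_2 cofactor_def d) (simp add: mat_delete_def)
qed

lemma char_poly_mat2:
  fixes A :: "'a :: field mat"
  assumes A: "A \<in> carrier_mat 2 2"
  shows "char_poly A
    = [:A $$ (0, 0) * A $$ (1, 1) - A $$ (0, 1) * A $$ (1, 0), - (A $$ (0, 0) + A $$ (1, 1)), 1:]"
proof -
  have "char_poly_matrix A \<in> carrier_mat 2 2"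
    using A by simp
  from det_mat2[OF this] show ?thesis
    using A by (simp add: char_poly_def char_poly_matrix_def)
qed

definition mat2 :: "'a \<Rightarrow> 'a \<Rightarrow> 'a \<Rightarrow> 'a \<Rightarrow> 'a mat" where
  "mat2 a b c d = mat_of_rows_list 2 [[a, b], [c, d]]"

lemma mat2_carrier [simp]: "mat2 a b c d \<in> carrier_mat 2 2"
  by (intro carrier_matI) (simp_all add: mat2_def mat_of_rows_list_def)

lemma mat2_dim [simp]: "dim_row (mat2 a b c d) = 2" "dim_col (mat2 a b c d) = 2"
  by (simp_all add: mat2_def mat_of_rows_list_def)

lemma mat2_index [simp]:
  "mat2 a b c d $$ (0, 0) = a" "mat2 a b c d $$ (0, Suc 0) = b"
  "mat2 a b c d $$ (Suc 0, 0) = c" "mat2 a b c d $$ (Suc 0, Suc 0) = d"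
  by (simp_all add: mat2_def mat_of_rows_list_def)

lemma mat2_eq_iff:
  "mat2 a b c d = mat2 a' b' c' d' \<longleftrightarrow> a = a' \<and> b = b' \<and> c = c' \<and> d = d'"
  by (metis mat2_index)

lemma mat2_mult:
  fixes a b c d :: "'a :: semiring_0"
  shows "mat2 a b c d * mat2 a' b' c' d'
    = mat2 (a * a' + b * c') (a * b' + b * d') (c * a' + d * c') (c * b' + d * d')"
  by (rule mat2_eqI) (auto simp: mat2_mult_index simp del: index_mult_mat(1))

lemma mat2_add: "mat2 a b c d + mat2 a' b' c' d' = mat2 (a + a') (b + b') (c + c') (d + d')"
  by (rule mat2_eqI) auto

lemma mat2_smult: "x \<cdot>\<^sub>m mat2 a b c d = mat2 (x * a) (x * b) (x * c) (x * d)"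
  by (rule mat2_eqI) auto

lemma cmat_mat2: "cmat (mat2 a b c d) = mat2 (of_real a) (of_real b) (of_real c) (of_real d)"
  by (rule mat2_eqI) auto

lemma mat_diag_2: "mat_diag 2 f = mat2 (f 0) 0 0 (f 1)"
  by (rule mat2_eqI) (auto simp: mat_diag_def)

lemma one_mat_2: "1\<^sub>m 2 = mat2 1 0 0 1"
  by (rule mat2_eqI) auto

section \<open>The Lambert W function of a matrix with zero top row\<close>

lemma diag_block_mat_smult:
  "diag_block_mat (map (\<lambda>A. c \<cdot>\<^sub>m A) As) = c \<cdot>\<^sub>m (diag_block_mat As :: 'a :: mult_zero mat)"
proof (induction As)
  case (Cons A As)
  then show ?case
    by (intro eq_matI) (auto simp: Let_def)
qed (auto intro!: eq_matI)

text \<open>The value is defined through an arbitrarily chosen Jordan decomposition, therefore the blocks of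
  all Jordan normal forms have to be considered.\<close>

lemma mat_lambert_W_eq_smult:
  assumes H: "H \<in> carrier_mat n n"
    and blocks: "\<And>n_as m a. jordan_nf H n_as \<Longrightarrow> (m, a) \<in> set n_as
      \<Longrightarrow> lambert_W_block k (m, a) = c \<cdot>\<^sub>m jordan_block m a"
  shows "mat_lambert_W k H = c \<cdot>\<^sub>m H"
proof -
  define P where "P = (\<lambda>(n_as, Z, Zinv). jordan_decomp H n_as Z Zinv)"
  define d where "d = (SOME x. P x)"
  obtain n_as Z Zinv where d: "d = (n_as, Z, Zinv)" by (cases d)
  obtain n_as' where "jordan_nf H n_as'"
    using char_poly_factorized[OF H] jordan_nf_exists[OF H] by blast
  then obtain Z' Zinv' where "jordan_decomp H n_as' Z' Zinv'"
    unfolding jordan_nf_def similar_mat_def jordan_decomp_def by blast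
  then have "P (n_as', Z', Zinv')" by (simp add: P_def)
  then have "P d" unfolding d_def by (rule someI[of P])
  then have dec: "jordan_decomp H n_as Z Zinv" by (simp add: P_def d)
  then have nf: "jordan_nf H n_as"
    unfolding jordan_nf_def similar_mat_def jordan_decomp_def by blast
  have wit: "similar_mat_wit H (jordan_matrix n_as) Z Zinv"
    using dec by (simp add: jordan_decomp_def)
  have "map (lambert_W_block k) n_as
      = map (\<lambda>A. c \<cdot>\<^sub>m A) (map (\<lambda>(m, a). jordan_block m a) n_as)"
    using blocks[OF nf] by auto
  then have "diag_block_mat (map (lambert_W_block k) n_as) = c \<cdot>\<^sub>m jordan_matrix n_as"
    by (simp only: diag_block_mat_smult jordan_matrix_def)
  then have "mat_lambert_W k H = Z * (c \<cdot>\<^sub>m jordan_matrix n_as) * Zinv"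
    using d by (simp add: mat_lambert_W_def d_def P_def)
  also have "\<dots> = c \<cdot>\<^sub>m H"
    using similar_mat_witD2(3)[OF _ similar_mat_wit_smult[OF wit, of c], of n n] H by simp
  finally show ?thesis .
qed

lemma lambert_W_block_size_1:
  assumes "lambert_W (if a = 0 then 0 else k) a = c * a"
  shows "lambert_W_block k (1, a) = c \<cdot>\<^sub>m jordan_block 1 a"
  using assms by (intro eq_matI) (auto simp: lambert_W_block_def lambert_W_deriv_def)

lemma lambert_W_0_0: "lambert_W 0 0 = 0"
  using lambert_W_0_of_real[of 0] by simp

text \<open>This is where \<open>W\<^sub>0'(0) = 1\<close> enters.\<close>

lemma lambert_W_block_nilpotent: "lambert_W_block k (2, 0) = jordan_block 2 0"
proof (rule mat2_eqI)
  show "lambert_W_block k (2, 0) $$ (0, 1) = jordan_block 2 0 $$ (0, 1)"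
    using lambert_W_deriv_0_1_0 by (simp add: lambert_W_block_def)
qed (auto simp: lambert_W_block_def lambert_W_deriv_def lambert_W_0_0)

context
  fixes H :: "complex mat" and h :: complex
  assumes H: "H \<in> carrier_mat 2 2"
    and top_row: "H $$ (0, 0) = 0" "H $$ (0, 1) = 0"
    and corner: "H $$ (1, 1) = h"
begin

text \<open>The characteristic polynomial is \<open>x (x - h)\<close>.  So only the eigenvalue \<open>0\<close> can have a block of
  size two, and this requires \<open>h = 0\<close>; blocks of \<open>- exp (-1)\<close> have size one, as the matrix
  function demands.\<close>

lemma jordan_block_size_le:
  assumes "jordan_nf H n_as" "(m, a) \<in> set n_as"
  shows "m \<le> (if a = 0 then 1 else 0) + (if a = h then 1 else 0)"
proof -
  have "char_poly H = [:- 0, 1:] ^ 1 * [:- h, 1:] ^ 1"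
    using char_poly_mat2[OF H] top_row corner by simp
  then have "order a (char_poly H) = order a ([:- 0, 1:] ^ 1) + order a ([:- h, 1:] ^ 1)"
    by (subst order_mult[symmetric]) (simp_all only: mult_eq_0_iff, simp)
  also have "\<dots> = (if a = 0 then 1 else 0) + (if a = h then 1 else 0)"
    unfolding order_linear_power by simp
  finally show ?thesis
    using jordan_nf_block_size_order_bound[OF assms] by simp
qed

lemma mat_lambert_W_defined_of_zero_top_row: "mat_lambert_W_defined k H"
  unfolding mat_lambert_W_defined_def
proof (intro impI allI)
  fix n_as m
  assume *: "jordan_nf H n_as \<and> (m, - exp (- 1)) \<in> set n_as"
  then have "m \<noteq> 0"
    by (force simp: jordan_nf_def)
  moreover have "m \<le> 1"
    using jordan_block_size_le[of n_as m "- exp (- 1)"] * by (simp split: if_splits)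
  ultimately show "m = 1" by simp
qed

text \<open>The factor \<open>exp (- w)\<close> is the ratio \<open>W\<^sub>k(a) / a\<close> at the eigenvalue \<open>a = h\<close>; at \<open>a = 0\<close>
  any factor is right for a block of size one, and a block of size two occurs only for \<open>h = 0\<close>,
  where the factor is \<open>1\<close>.\<close>

lemma mat_lambert_W_of_zero_top_row:
  assumes h: "h = of_real (w * exp w)"
    and branch: "k = 0 \<and> - 1 \<le> w \<or> k = - 1 \<and> w \<le> - 1"
  shows "mat_lambert_W k H = of_real (exp (- w)) \<cdot>\<^sub>m H"
proof (rule mat_lambert_W_eq_smult[OF H])
  have Wh: "lambert_W k h = of_real w"
    using lambert_W_0_of_real[of w] lambert_W_minus_1_of_real[of w] branch unfolding h by blast
  have wh: "of_real w = of_real (exp (- w)) * h"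
    unfolding h of_real_mult[symmetric] by (simp add: exp_minus)
  fix n_as m a
  assume nf: "jordan_nf H n_as" "(m, a) \<in> set n_as"
  then have "m \<noteq> 0"
    by (force simp: jordan_nf_def)
  with jordan_block_size_le[OF nf] have "m = 1 \<and> (a = 0 \<or> a = h) \<or> m = 2 \<and> a = 0 \<and> h = 0"
    by (auto split: if_splits)
  then consider "m = 1" "a = 0 \<or> a = h" | "m = 2" "a = 0" "h = 0"
    by blast
  then show "lambert_W_block k (m, a) = of_real (exp (- w)) \<cdot>\<^sub>m jordan_block m a"
  proof cases
    case 1
    then have "lambert_W (if a = 0 then 0 else k) a = of_real (exp (- w)) * a"
      using lambert_W_0_0 Wh wh by auto
    with 1 show ?thesis by (simp only: lambert_W_block_size_1)
  next
    case 2
    then have "w = 0" using h by simp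
    have "lambert_W_block k (m, a) = jordan_block m a"
      using 2 lambert_W_block_nilpotent by simp
    also have "\<dots> = of_real (exp (- w)) \<cdot>\<^sub>m jordan_block m a"
      using \<open>w = 0\<close> by (intro eq_matI) auto
    finally show ?thesis .
  qed
qed

end

section \<open>Companion matrices and the delay system\<close>

lemma companion_diagonalization:
  fixes a b :: complex
  assumes "a \<noteq> b"
  shows "similar_mat_wit (mat2 0 1 (- (a * b)) (a + b)) (mat_diag 2 (\<lambda>i. if i = 0 then a else b))
    (mat2 1 1 a b) (mat2 (b / (b - a)) (- 1 / (b - a)) (- a / (b - a)) (1 / (b - a)))"
    (is "similar_mat_wit ?C ?D ?P ?Q")
proof (rule similar_mat_witI)
  have ba: "b - a \<noteq> 0" using assms by simp
  show "?P * ?Q = 1\<^sub>m 2" "?Q * ?P = 1\<^sub>m 2"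
    unfolding one_mat_2 mat2_mult mat2_eq_iff
    using ba by (auto simp: divide_simps)
  show "?C = ?P * ?D * ?Q"
    unfolding mat_diag_2 mat2_mult mat2_eq_iff
    using ba by (auto simp: divide_simps) (auto simp: algebra_simps)
qed (simp_all add: mat_diag_2)

lemma companion_spectrum:
  fixes a b :: complex
  shows "spectrum (mat2 0 1 (- (a * b)) (a + b)) = {a, b}"
proof -
  have "poly (char_poly (mat2 0 1 (- (a * b)) (a + b))) x = (x - a) * (x - b)" for x
    by (simp add: char_poly_mat2 algebra_simps)
  then show ?thesis
    by (auto simp: spectrum_root_char_poly[of _ 2])
qed

text \<open>It suffices to verify \<open>W exp (t S) = B\<close> on a basis of eigenvectors of \<open>S\<close>, the columns
  of \<open>V\<close>.\<close>

lemma mult_mat_exp_eqI: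
  fixes t :: complex
  assumes S: "S \<in> carrier_mat n n" and W: "W \<in> carrier_mat n n" and B: "B \<in> carrier_mat n n"
    and wit: "similar_mat_wit S (mat_diag n d) V Vinv"
    and eigen: "W * V * mat_diag n (\<lambda>i. exp (t * d i)) = B * V"
  shows "W * mat_exp (t \<cdot>\<^sub>m S) = B"
proof -
  note V = similar_mat_witD2(1,6,7)[OF S wit]
  have "t \<cdot>\<^sub>m mat_diag n d = mat_diag n (\<lambda>i. t * d i)"
    by (intro eq_matI) (auto simp: mat_diag_def)
  then have wit': "similar_mat_wit (t \<cdot>\<^sub>m S) (mat_diag n (\<lambda>i. t * d i)) V Vinv"
    using similar_mat_wit_smult[OF wit, of t] by simp
  let ?E = "mat_diag n (\<lambda>i. exp (t * d i))"
  have "W * mat_exp (t \<cdot>\<^sub>m S) = W * (V * ?E * Vinv)"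
    using mat_exp_diagonalizable[OF _ wit'] S by simp
  also have "\<dots> = W * V * ?E * Vinv"
    using W V by (simp add: assoc_mult_mat[of _ n n _ n _ n])
  also have "\<dots> = B * (V * Vinv)"
    unfolding eigen using B V(2,3) by (simp add: assoc_mult_mat[of _ n n _ n _ n])
  also have "\<dots> = B"
    using B V(1) by simp
  finally show ?thesis .
qed

lemma char_fun_companion:
  assumes "A = mat2 0 1 a21 a22" "B = mat2 0 0 b21 b22"
  shows "char_fun A B \<tau> s
    = s\<^sup>2 - of_real a22 * s - of_real a21 - exp (- s * of_real \<tau>) * (of_real b22 * s + of_real b21)"
proof -
  let ?D = "s \<cdot>\<^sub>m 1\<^sub>m (dim_row A) - cmat A - exp (- s * of_real \<tau>) \<cdot>\<^sub>m cmat B"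
  have "?D \<in> carrier_mat 2 2"
    using assms by (auto intro!: carrier_matI)
  from det_mat2[OF this] show ?thesis
    unfolding char_fun_def by (simp add: assms power2_eq_square algebra_simps)
qed

theorem proposition1:
  fixes \<tau> a21 a22 b21 b22 :: real and A B :: "real mat" and \<mu> :: complex
  assumes "\<tau> > 0"
    and "A = mat_of_rows_list 2 [[0, 1], [a21, a22]]"
    and "B = mat_of_rows_list 2 [[0, 0], [b21, b22]]"
    and "Im \<mu> \<noteq> 0"
    and "char_root A B \<tau> \<mu>" and "char_root A B \<tau> (cnj \<mu>)"
    and "char_root_mult A B \<tau> \<mu> = 1" and "char_root_mult A B \<tau> (cnj \<mu>) = 1"
  shows "\<exists>k \<in> {0, -1 :: int}. \<exists>M \<in> carrier_mat 2 2. \<exists>Q \<in> carrier_mat 2 2.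
    M = (\<tau> \<cdot>\<^sub>m B) * Q \<and>
    mat_lambert_W_defined k (cmat M) \<and>
    mat_lambert_W k (cmat M) * mat_exp (mat_lambert_W k (cmat M) + of_real \<tau> \<cdot>\<^sub>m cmat A)
      - of_real \<tau> \<cdot>\<^sub>m cmat B = 0\<^sub>m 2 2 \<and>
    spectrum (of_real (1 / \<tau>) \<cdot>\<^sub>m mat_lambert_W k (cmat M) + cmat A) = {\<mu>, cnj \<mu>}"
proof -
  note \<tau> = assms(1)
  have A: "A = mat2 0 1 a21 a22" and B: "B = mat2 0 0 b21 b22"
    using assms(2,3) by (simp_all add: mat2_def)
  \<comment> \<open>The bottom row of the companion matrix that \<open>S\<close> has to be, and, by \<open>W = \<tau> (S - A)\<close>, the bottom
    row of \<open>W\<^sub>k(M)\<close>.\<close>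
  define c1 c2 where "c1 = - ((Re \<mu>)\<^sup>2 + (Im \<mu>)\<^sup>2)" and "c2 = 2 * Re \<mu>"
  have c: "of_real c1 = - (\<mu> * cnj \<mu>)" "of_real c2 = \<mu> + cnj \<mu>"
    unfolding complex_mult_cnj complex_add_cnj by (simp_all add: c1_def c2_def)
  define w1 w2 where "w1 = \<tau> * (c1 - a21)" and "w2 = \<tau> * (c2 - a22)"
  define M where "M = mat2 0 0 (w1 * exp w2) (w2 * exp w2)"
  define k :: int where "k = (if - 1 \<le> w2 then 0 else - 1)"
  define S where "S = mat2 0 1 (- (\<mu> * cnj \<mu>)) (\<mu> + cnj \<mu>)"
  define W where "W = mat_lambert_W k (cmat M)"
  \<comment> \<open>The characteristic equation, multiplied by \<open>\<tau> exp (\<tau> z)\<close>.\<close>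
  have char: "of_real \<tau> * (z\<^sup>2 - of_real a22 * z - of_real a21) * exp (of_real \<tau> * z)
      = of_real \<tau> * (of_real b22 * z + of_real b21)" if "char_root A B \<tau> z" for z
  proof -
    have "z\<^sup>2 - of_real a22 * z - of_real a21 = exp (- z * of_real \<tau>) * (of_real b22 * z + of_real b21)"
      using that char_fun_companion[OF A B] by (simp add: char_root_def)
    then show ?thesis
      by (simp add: exp_minus field_simps)
  qed
  have M: "cmat M = mat2 0 0 (of_real (w1 * exp w2)) (of_real (w2 * exp w2))"
    by (simp add: M_def cmat_mat2)
  have W: "W = mat2 0 0 (of_real w1) (of_real w2)"
  proof -
    have "W = of_real (exp (- w2)) \<cdot>\<^sub>m cmat M"
      unfolding W_def
      by (rule mat_lambert_W_of_zero_top_row[where w = w2]) (auto simp: M k_def)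
    then show ?thesis
      by (simp add: M mat2_smult mat2_eq_iff exp_minus)
  qed
  have "mat_lambert_W_defined k (cmat M)"
    by (rule mat_lambert_W_defined_of_zero_top_row) (auto simp: M)
  moreover have "of_real (1 / \<tau>) \<cdot>\<^sub>m W + cmat A = S"
    using \<tau> by (simp add: W A S_def cmat_mat2 mat2_smult mat2_add w1_def w2_def flip: c)
  then have "spectrum (of_real (1 / \<tau>) \<cdot>\<^sub>m W + cmat A) = {\<mu>, cnj \<mu>}"
    by (simp add: S_def companion_spectrum)
  moreover have "W * mat_exp (W + of_real \<tau> \<cdot>\<^sub>m cmat A) - of_real \<tau> \<cdot>\<^sub>m cmat B = 0\<^sub>m 2 2"
  proof -
    have "W + of_real \<tau> \<cdot>\<^sub>m cmat A = of_real \<tau> \<cdot>\<^sub>m S"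
      by (simp add: W A S_def cmat_mat2 mat2_smult mat2_add w1_def w2_def algebra_simps flip: c)
    moreover have "W * mat_exp (of_real \<tau> \<cdot>\<^sub>m S) = of_real \<tau> \<cdot>\<^sub>m cmat B"
    proof (rule mult_mat_exp_eqI)
      have "\<mu> \<noteq> cnj \<mu>"
        using assms(4) by (simp add: complex_eq_iff)
      then show "similar_mat_wit S (mat_diag 2 (\<lambda>i. if i = 0 then \<mu> else cnj \<mu>)) (mat2 1 1 \<mu> (cnj \<mu>))
          (mat2 (cnj \<mu> / (cnj \<mu> - \<mu>)) (- 1 / (cnj \<mu> - \<mu>)) (- \<mu> / (cnj \<mu> - \<mu>)) (1 / (cnj \<mu> - \<mu>)))"
        unfolding S_def by (rule companion_diagonalization)
      have "of_real w1 + of_real w2 * z = of_real \<tau> * (z\<^sup>2 - of_real a22 * z - of_real a21)"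
        if "z = \<mu> \<or> z = cnj \<mu>" for z
        using that by (auto simp: w1_def w2_def c power2_eq_square algebra_simps)
      then have "(of_real w1 + of_real w2 * z) * exp (of_real \<tau> * z)
          = of_real \<tau> * (of_real b22 * z + of_real b21)" if "z = \<mu> \<or> z = cnj \<mu>" for z
        using that char assms(5,6) by metis
      from this[of \<mu>] this[of "cnj \<mu>"] show "W * mat2 1 1 \<mu> (cnj \<mu>)
          * mat_diag 2 (\<lambda>i. exp (of_real \<tau> * (if i = 0 then \<mu> else cnj \<mu>)))
        = of_real \<tau> \<cdot>\<^sub>m cmat B * mat2 1 1 \<mu> (cnj \<mu>)"
        by (simp add: W B cmat_mat2 mat_diag_2 mat2_mult mat2_smult mat2_eq_iff algebra_simps)
    qed (simp_all add: S_def W B)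
    ultimately show ?thesis
      by (simp add: B)
  qed
  moreover have "\<exists>Q \<in> carrier_mat 2 2. M = (\<tau> \<cdot>\<^sub>m B) * Q"
  proof (cases "b21 = 0 \<and> b22 = 0")
    case True
    \<comment> \<open>Without delay term, \<open>\<mu>\<close> is an eigenvalue of the real companion matrix \<open>A\<close>, whose bottom row it
      determines because it is not real.\<close>
    have "\<mu>\<^sup>2 - of_real a22 * \<mu> - of_real a21 = 0"
      using char[OF assms(5)] True \<tau> by simp
    then have "Re \<mu> * Re \<mu> - Im \<mu> * Im \<mu> - a22 * Re \<mu> - a21 = 0"
      "Im \<mu> * (2 * Re \<mu> - a22) = 0"
      by (simp_all add: complex_eq_iff power2_eq_square algebra_simps)
    then have "c2 = a22" "c1 = a21"
      using assms(4) by (auto simp: c1_def c2_def power2_eq_square algebra_simps)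
    then have "M = (\<tau> \<cdot>\<^sub>m B) * mat2 0 0 0 0"
      by (simp add: M_def B w1_def w2_def mat2_smult mat2_mult)
    then show ?thesis by (rule bexI) simp
  next
    case False
    \<comment> \<open>\<open>Q\<close> is the transposed bottom row of \<open>B\<close> times the bottom row of \<open>M\<close>, divided by \<open>r\<close>.\<close>
    define r where "r = \<tau> * (b21\<^sup>2 + b22\<^sup>2)"
    have r: "r \<noteq> 0"
      using False \<tau> by (simp add: r_def sum_power2_eq_zero_iff)
    have row: "\<tau> * b21 * (b21 * x) / r + \<tau> * b22 * (b22 * x) / r = x" for x
    proof -
      have "\<tau> * b21 * (b21 * x) / r + \<tau> * b22 * (b22 * x) / r = r * x / r"
        by (simp add: r_def power2_eq_square add_divide_distrib distrib_left distrib_right mult_ac)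
      with r show ?thesis by simp
    qed
    have "M = (\<tau> \<cdot>\<^sub>m B) * mat2 (b21 * (w1 * exp w2) / r) (b21 * (w2 * exp w2) / r)
        (b22 * (w1 * exp w2) / r) (b22 * (w2 * exp w2) / r)"
      by (simp add: M_def B mat2_smult mat2_mult row)
    then show ?thesis by (rule bexI) simp
  qed
  moreover have "k \<in> {0, - 1}" "M \<in> carrier_mat 2 2"
    by (simp_all add: k_def M_def)
  ultimately show ?thesis
    unfolding W_def by blast
qed

end
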